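(* Assume that the linearizations $\mathcal{L}_u^{PDE}$, $\mathcal{L}_u^{BC}$ of the nonlinear operators $\mathcal{W}^{PDE}$, $\mathcal{W}^{BC}$ described in the context exist, and that all operators are regular enough so that $\mathcal{W}(u+v)=\mathcal{W}(u)+\mathcal{L}_uv+O(\|v\|^2)$. Let every iteration of the operator-Newton method (without smoothing) be implemented by RBF collocation on the same pointset $\{\mathbf{x}_1,\dots,\mathbf{x}_N\}$ with the same RBF $\phi$. Let $\vec\alpha_k$ be the RBF coefficients of the current iterate $\tilde u_k$, let $J_k$ be the Jacobian at $\vec\alpha_k$ of the nonlinear collocation system $\vec W(\vec\alpha)=(W_1(\vec\alpha),\dots,W_N(\vec\alpha))^T$, with entries $\partial W_i/\partial\alpha_j$, and let $[\mathcal{L}_k\phi]$ be the collocation matrix of the operators linearized around $\tilde u_k$, with entries $\mathcal{L}_k\phi_{ij}=(\mathcal{L}_{\tilde u_k}\phi_j)(\mathbf{x}_i)$. Then $$(J_k)_{ij}=\mathcal{L}_k\phi_{ij},\qquad 1\le i,j\le N,$$ i.e. $[\mathcal{L}_k\phi]=J_k$. Consequently the update of the collocated operator-Newton method, obtained by inverting the collocation system $[\mathcal{L}_k\phi]\vec\gamma=-\vec W_k$ with $\vec W_k=\vec W(\vec\alpha_k)$ and adding $\vec\gamma$ to $\vec\alpha_k$, is $$\vec\alpha_{k+1}=\vec\alpha_k-[\mathcal{L}_k\phi]^{-1}\vec W_k=\vec\alpha_k-J_k^{-1}\vec W_k,$$ which is Newton's method for the system $\vec W(\vec\alpha)=0$.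 Thus the collocated operator-Newton method (without smoothing) is, like Newton's method, not globally convergent (convergence is not assured from any initial guess).
   Context: $\Omega\subset\mathbb{R}^d$ is a bounded domain, and the nonlinear elliptic boundary value problem is $\mathcal{W}^{PDE}u=0$ in $\Omega$, $\mathcal{W}^{BC}u=0$ on $\partial\Omega$. $\mathbf{x}_1,\dots,\mathbf{x}_N$ are distinct points, the first $M$ in $\Omega$ and the last $N-M$ on $\partial\Omega$. $\phi:[0,\infty)\to\mathbb{R}$ is a radial basis function (RBF), $\phi_j(\mathbf{x})=\phi(\|\mathbf{x}-\mathbf{x}_j\|)$, and $\tilde u(\vec\alpha)=\sum_{j=1}^N\alpha_j\phi_j$. Collocation system: $W_i(\vec\alpha)=(\mathcal{W}^{PDE}\tilde u(\vec\alpha))(\mathbf{x}_i)$ for $i\le M$ and $W_i(\vec\alpha)=(\mathcal{W}^{BC}\tilde u(\vec\alpha))(\mathbf{x}_i)$ for $i>M$. Likewise $(\mathcal{L}_uv)(\mathbf{x}_i)$ means $(\mathcal{L}^{PDE}_uv)(\mathbf{x}_i)$ for $i\le M$ and $(\mathcal{L}^{BC}_uv)(\mathbf{x}_i)$ for $i>M$. Linearization: for a nonlinear operator $\mathcal{W}$ (either $\mathcal{W}^{PDE}$ or $\mathcal{W}^{BC}$), the linearization (Fréchet derivative) around a function $u$ is the linear operator $\mathcal{L}_u$ such that $\lim_{\|v\|\to0}\big(\mathcal{W}(u+v)-\mathcal{W}u-\mathcal{L}_uv\big)/\|v\|=0$. Operator-Newton method without smoothing: given the current iterate $u_k$, solve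 the linear boundary value problem $\mathcal{L}^{PDE}_{u_k}v=-\mathcal{W}^{PDE}u_k$ in $\Omega$, $\mathcal{L}^{BC}_{u_k}v=-\mathcal{W}^{BC}u_k$ on $\partial\Omega$, and set $u_{k+1}=u_k+v$. In its RBF-collocated version, $u_k=\tilde u(\vec\alpha_k)$ and $v=\tilde u(\vec\gamma)$; the linear problem is enforced at $\mathbf{x}_1,\dots,\mathbf{x}_N$ (the PDE for $i\le M$, the boundary condition for $i>M$), which gives the system $[\mathcal{L}_k\phi]\vec\gamma=-\vec W_k$, and $\vec\alpha_{k+1}=\vec\alpha_k+\vec\gamma$. *)

theory Defs
  imports "HOL-Analysis.Analysis"
begin

text \<open>
  Functions on the closure of the domain are represented by total functions, of which only the
  values on the closure matter; \<open>nrm\<close> is therefore definite up to equality on \<open>D\<close>.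
\<close>

definition normed_function_space ::
  "'a set \<Rightarrow> ('a \<Rightarrow> real) set \<Rightarrow> (('a \<Rightarrow> real) \<Rightarrow> real) \<Rightarrow> bool" where
  "normed_function_space D X nrm \<longleftrightarrow>
     (\<lambda>_. 0) \<in> X \<and>
     (\<forall>u\<in>X. \<forall>v\<in>X. (\<lambda>y. u y + v y) \<in> X \<and> nrm (\<lambda>y. u y + v y) \<le> nrm u + nrm v) \<and>
     (\<forall>c. \<forall>u\<in>X. (\<lambda>y. c * u y) \<in> X \<and> nrm (\<lambda>y. c * u y) = \<bar>c\<bar> * nrm u) \<and>
     (\<forall>u\<in>X. nrm u = 0 \<longleftrightarrow> (\<forall>y\<in>D. u y = 0))"

definition acts_on_values ::
  "'a set \<Rightarrow> ('a \<Rightarrow> real) set \<Rightarrow> 'a set \<Rightarrow> (('a \<Rightarrow> real) \<Rightarrow> 'a \<Rightarrow> real) \<Rightarrow> bool" where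
  "acts_on_values D X S W \<longleftrightarrow>
     (\<forall>u\<in>X. \<forall>v\<in>X. (\<forall>y\<in>D. u y = v y) \<longrightarrow> (\<forall>y\<in>S. W u y = W v y))"

text \<open>
  \<open>L u\<close> is the linearization (Frechet derivative) of \<open>W\<close> around \<open>u\<close>, for every \<open>u\<close> in the space.
  Values of the operators are functions on \<open>S\<close> (the domain for the differential operator, its
  frontier for the boundary operator) and are compared uniformly on \<open>S\<close>.
\<close>

definition is_linearization ::
  "('a \<Rightarrow> real) set \<Rightarrow> (('a \<Rightarrow> real) \<Rightarrow> real) \<Rightarrow> 'a set \<Rightarrow> (('a \<Rightarrow> real) \<Rightarrow> 'a \<Rightarrow> real) \<Rightarrow>
   (('a \<Rightarrow> real) \<Rightarrow> ('a \<Rightarrow> real) \<Rightarrow> 'a \<Rightarrow> real) \<Rightarrow> bool" where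
  "is_linearization X nrm S W L \<longleftrightarrow>
     (\<forall>u\<in>X.
        (\<forall>v\<in>X. \<forall>w\<in>X. \<forall>y\<in>S. L u (\<lambda>z. v z + w z) y = L u v y + L u w y) \<and>
        (\<forall>c. \<forall>v\<in>X. \<forall>y\<in>S. L u (\<lambda>z. c * v z) y = c * L u v y) \<and>
        uniform_limit S (\<lambda>v y. (W (\<lambda>z. u z + v z) y - W u y - L u v y) / nrm v) (\<lambda>_. 0)
          (inf (principal X) (filtercomap nrm (at 0))))"

definition has_quadratic_remainder ::
  "('a \<Rightarrow> real) set \<Rightarrow> (('a \<Rightarrow> real) \<Rightarrow> real) \<Rightarrow> 'a set \<Rightarrow> (('a \<Rightarrow> real) \<Rightarrow> 'a \<Rightarrow> real) \<Rightarrow>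
   (('a \<Rightarrow> real) \<Rightarrow> ('a \<Rightarrow> real) \<Rightarrow> 'a \<Rightarrow> real) \<Rightarrow> bool" where
  "has_quadratic_remainder X nrm S W L \<longleftrightarrow>
     (\<forall>u\<in>X. \<exists>C. eventually
        (\<lambda>v. \<forall>y\<in>S. \<bar>W (\<lambda>z. u z + v z) y - W u y - L u v y\<bar> \<le> C * (nrm v)\<^sup>2)
        (inf (principal X) (filtercomap nrm (nhds 0))))"

text \<open>
  \<open>interior_idx\<close> plays the role of \<open>{1..M}\<close> in the index set \<open>{1..N}\<close>, here a finite type \<open>'n\<close>.
\<close>

record ('a, 'n) rbf_problem =
  domain_of :: "'a set"
  space_of :: "('a \<Rightarrow> real) set"
  norm_of :: "('a \<Rightarrow> real) \<Rightarrow> real"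
  W_PDE :: "('a \<Rightarrow> real) \<Rightarrow> 'a \<Rightarrow> real"
  W_BC :: "('a \<Rightarrow> real) \<Rightarrow> 'a \<Rightarrow> real"
  L_PDE :: "('a \<Rightarrow> real) \<Rightarrow> ('a \<Rightarrow> real) \<Rightarrow> 'a \<Rightarrow> real"
  L_BC :: "('a \<Rightarrow> real) \<Rightarrow> ('a \<Rightarrow> real) \<Rightarrow> 'a \<Rightarrow> real"
  rbf :: "real \<Rightarrow> real"
  node :: "'n \<Rightarrow> 'a"
  interior_idx :: "'n set"

definition rbf_at :: "('a::euclidean_space, 'n) rbf_problem \<Rightarrow> 'n \<Rightarrow> 'a \<Rightarrow> real" where
  "rbf_at P j y = rbf P (norm (y - node P j))"

definition rbf_interpolant ::
  "('a::euclidean_space, 'n::finite) rbf_problem \<Rightarrow> real ^ 'n \<Rightarrow> 'a \<Rightarrow> real" where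
  "rbf_interpolant P \<alpha> y = (\<Sum>j\<in>UNIV. \<alpha> $ j * rbf_at P j y)"

definition rbf_setting :: "('a::euclidean_space, 'n::finite) rbf_problem \<Rightarrow> bool" where
  "rbf_setting P \<longleftrightarrow>
     open (domain_of P) \<and> connected (domain_of P) \<and> domain_of P \<noteq> {} \<and> bounded (domain_of P) \<and>
     inj (node P) \<and>
     (\<forall>i\<in>interior_idx P. node P i \<in> domain_of P) \<and>
     (\<forall>i. i \<notin> interior_idx P \<longrightarrow> node P i \<in> frontier (domain_of P)) \<and>
     normed_function_space (closure (domain_of P)) (space_of P) (norm_of P) \<and>
     (\<forall>j. rbf_at P j \<in> space_of P) \<and>
     acts_on_values (closure (domain_of P)) (space_of P) (domain_of P) (W_PDE P) \<and>
     acts_on_values (closure (domain_of P)) (space_of P) (frontier (domain_of P)) (W_BC P) \<and>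
     is_linearization (space_of P) (norm_of P) (domain_of P) (W_PDE P) (L_PDE P) \<and>
     is_linearization (space_of P) (norm_of P) (frontier (domain_of P)) (W_BC P) (L_BC P) \<and>
     has_quadratic_remainder (space_of P) (norm_of P) (domain_of P) (W_PDE P) (L_PDE P) \<and>
     has_quadratic_remainder (space_of P) (norm_of P) (frontier (domain_of P)) (W_BC P) (L_BC P)"

definition W_at :: "('a::euclidean_space, 'n) rbf_problem \<Rightarrow> ('a \<Rightarrow> real) \<Rightarrow> 'n \<Rightarrow> real" where
  "W_at P u i = (if i \<in> interior_idx P then W_PDE P u (node P i) else W_BC P u (node P i))"

definition L_at ::
  "('a::euclidean_space, 'n) rbf_problem \<Rightarrow> ('a \<Rightarrow> real) \<Rightarrow> ('a \<Rightarrow> real) \<Rightarrow> 'n \<Rightarrow> real" where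
  "L_at P u v i = (if i \<in> interior_idx P then L_PDE P u v (node P i) else L_BC P u v (node P i))"

definition colloc_system ::
  "('a::euclidean_space, 'n::finite) rbf_problem \<Rightarrow> real ^ 'n \<Rightarrow> real ^ 'n" where
  "colloc_system P \<alpha> = (\<chi> i. W_at P (rbf_interpolant P \<alpha>) i)"

definition colloc_matrix ::
  "('a::euclidean_space, 'n::finite) rbf_problem \<Rightarrow> real ^ 'n \<Rightarrow> real ^ 'n ^ 'n" where
  "colloc_matrix P \<alpha> = (\<chi> i j. L_at P (rbf_interpolant P \<alpha>) (rbf_at P j) i)"

text \<open>
  The linearized boundary value problem for the correction \<open>v\<close>, an RBF interpolant with
  coefficients \<open>\<gamma>\<close>, enforced at the nodes.
\<close>

definition collocated_correction ::
  "('a::euclidean_space, 'n::finite) rbf_problem \<Rightarrow> real ^ 'n \<Rightarrow> real ^ 'n \<Rightarrow> bool" where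
  "collocated_correction P \<alpha> \<gamma> \<longleftrightarrow>
     (\<forall>i. L_at P (rbf_interpolant P \<alpha>) (rbf_interpolant P \<gamma>) i = - W_at P (rbf_interpolant P \<alpha>) i)"

definition operator_newton_iteration ::
  "('a::euclidean_space, 'n::finite) rbf_problem \<Rightarrow> (nat \<Rightarrow> real ^ 'n) \<Rightarrow> bool" where
  "operator_newton_iteration P \<alpha> \<longleftrightarrow>
     (\<forall>k. invertible (colloc_matrix P (\<alpha> k)) \<and>
          (\<exists>\<gamma>. collocated_correction P (\<alpha> k) \<gamma> \<and> \<alpha> (Suc k) = \<alpha> k + \<gamma>))"

definition newton_iteration :: "(real ^ 'n \<Rightarrow> real ^ 'n) \<Rightarrow> (nat \<Rightarrow> real ^ 'n::finite) \<Rightarrow> bool" where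
  "newton_iteration F \<alpha> \<longleftrightarrow>
     (\<forall>k. F differentiable (at (\<alpha> k)) \<and> invertible (jacobian F (at (\<alpha> k))) \<and>
          \<alpha> (Suc k) = \<alpha> k - matrix_inv (jacobian F (at (\<alpha> k))) *v F (\<alpha> k))"

definition partial :: "'a::euclidean_space \<Rightarrow> ('a \<Rightarrow> real) \<Rightarrow> 'a \<Rightarrow> real" where
  "partial b u y = deriv (\<lambda>t. u (y + t *\<^sub>R b)) 0"

definition C2_on :: "'a::euclidean_space set \<Rightarrow> ('a \<Rightarrow> real) \<Rightarrow> bool" where
  "C2_on S u \<longleftrightarrow>
     (\<forall>y\<in>S. u differentiable (at y)) \<and>
     (\<forall>b\<in>Basis. (\<forall>y\<in>S. partial b u differentiable (at y)) \<and>
                 (\<forall>c\<in>Basis. continuous_on S (partial c (partial b u))))"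

text \<open>
  A fully nonlinear second-order operator is elliptic if the principal symbol of each of its
  linearizations vanishes at no nonzero covector. The function space has to contain all twice
  continuously differentiable functions, since otherwise the coefficients of the linearization
  would not be determined by its action.
\<close>

definition elliptic_problem :: "('a::euclidean_space, 'n) rbf_problem \<Rightarrow> bool" where
  "elliptic_problem P \<longleftrightarrow>
     Collect (C2_on UNIV) \<subseteq> space_of P \<and> space_of P \<subseteq> Collect (C2_on (domain_of P)) \<and>
     (\<exists>F. \<forall>u\<in>space_of P. \<forall>y\<in>domain_of P.
        W_PDE P u y = F y (u y) (\<lambda>b. partial b u y) (\<lambda>b c. partial b (partial c u) y)) \<and>
     (\<forall>u\<in>space_of P. \<exists>A B C.
        (\<forall>y\<in>domain_of P. \<forall>\<xi>. \<xi> \<noteq> 0 \<longrightarrow> (\<Sum>b\<in>Basis. \<Sum>c\<in>Basis. A y b c * (\<xi> \<bullet> b) * (\<xi> \<bullet> c)) \<noteq> 0) \<and>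
        (\<forall>v\<in>space_of P. \<forall>y\<in>domain_of P.
           L_PDE P u v y =
             (\<Sum>b\<in>Basis. \<Sum>c\<in>Basis. A y b c * partial b (partial c v) y) +
             (\<Sum>b\<in>Basis. B y b * partial b v y) + C y * v y))"

end

(* The quadratic remainder bounds W(u + v) - W u - L_u v at the nodes by C |v|^2, and the norm of an
   interpolant is at most a constant times that of its coefficient vector. So the linear map
   gamma |-> L_u(interpolant of gamma), whose matrix is the collocation matrix, is the derivative of
   the collocation system. Linearly dependent basis functions do no harm, since the bound also
   covers v of norm 0.

   For the failure of global convergence, the semilinear equation Lap u + u^3 - (2 d + 5) u = 0 on
   the unit ball with zero boundary values, one node at the centre, one on the sphere and
   phi(r) = r^2, restricts to Newton's method for s^3 - 5 s, which has the two-cycle 1, -1. *)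
theory Submission
  imports Defs
begin

subsection \<open>Function spaces and remainders\<close>

lemma normed_function_spaceD:
  assumes "normed_function_space D X nrm"
  shows "(\<lambda>_. 0) \<in> X"
    and "u \<in> X \<Longrightarrow> v \<in> X \<Longrightarrow> (\<lambda>y. u y + v y) \<in> X"
    and "u \<in> X \<Longrightarrow> v \<in> X \<Longrightarrow> nrm (\<lambda>y. u y + v y) \<le> nrm u + nrm v"
    and "u \<in> X \<Longrightarrow> (\<lambda>y. c * u y) \<in> X"
    and "u \<in> X \<Longrightarrow> nrm (\<lambda>y. c * u y) = \<bar>c\<bar> * nrm u"
    and "nrm (\<lambda>_. 0) = 0"
  using assms unfolding normed_function_space_def by simp_all

text \<open>Not among the axioms: it follows from 0 = \<open>nrm\<close> (u - u) \<le>
  \<open>nrm\<close> u + \<open>nrm\<close> (-u) = 2 \<open>nrm\<close> u.\<close>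

lemma normed_function_space_nonneg:
  assumes X: "normed_function_space D X nrm" and u: "u \<in> X"
  shows "0 \<le> nrm u"
proof -
  have "nrm (\<lambda>y. u y + (-1) * u y) \<le> nrm u + nrm (\<lambda>y. (-1) * u y)"
    using u by (intro normed_function_spaceD(3)[OF X] normed_function_spaceD(4)[OF X])
  moreover have "nrm (\<lambda>y. u y + (-1) * u y) = 0"
    using normed_function_spaceD(6)[OF X] by simp
  moreover have "nrm (\<lambda>y. (-1) * u y) = nrm u"
    using normed_function_spaceD(5)[OF X u, of "-1"] by simp
  ultimately show ?thesis
    by simp
qed

text \<open>Membership and bound go through one induction, since the triangle inequality for the
  inserted term needs the remaining sum to lie in the space.\<close>

lemma normed_function_space_sum:
  assumes X: "normed_function_space D X nrm" and f: "\<And>j. j \<in> A \<Longrightarrow> f j \<in> X" and "finite A"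
  shows "(\<lambda>y. \<Sum>j\<in>A. c j * f j y) \<in> X"
    and "nrm (\<lambda>y. \<Sum>j\<in>A. c j * f j y) \<le> (\<Sum>j\<in>A. \<bar>c j\<bar> * nrm (f j))"
proof -
  have "(\<lambda>y. \<Sum>j\<in>A. c j * f j y) \<in> X \<and>
      nrm (\<lambda>y. \<Sum>j\<in>A. c j * f j y) \<le> (\<Sum>j\<in>A. \<bar>c j\<bar> * nrm (f j))"
    using \<open>finite A\<close> f
  proof (induction A rule: finite_induct)
    case empty
    then show ?case
      by (simp add: normed_function_spaceD(1,6)[OF X])
  next
    case (insert a A)
    let ?s = "\<lambda>y. \<Sum>j\<in>A. c j * f j y"
    have a: "f a \<in> X" and s: "?s \<in> X" "nrm ?s \<le> (\<Sum>j\<in>A. \<bar>c j\<bar> * nrm (f j))"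
      using insert by simp_all
    have "(\<lambda>y. c a * f a y + ?s y) \<in> X"
         "nrm (\<lambda>y. c a * f a y + ?s y) \<le> nrm (\<lambda>y. c a * f a y) + nrm ?s"
      by (intro normed_function_spaceD(2-4)[OF X] a s)+
    then show ?case
      using insert.hyps s(2) normed_function_spaceD(5)[OF X a, of "c a"] by simp
  qed
  then show "(\<lambda>y. \<Sum>j\<in>A. c j * f j y) \<in> X"
    "nrm (\<lambda>y. \<Sum>j\<in>A. c j * f j y) \<le> (\<Sum>j\<in>A. \<bar>c j\<bar> * nrm (f j))"
    by blast+
qed

text \<open>Because the filter pulls back \<open>nhds 0\<close> and not \<open>at 0\<close>, the
  right-hand side also covers elements of norm zero; coefficient vectors whose interpolant vanishes
  on the closure depend on this.\<close>

lemma eventually_small_norm_iff: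
  "eventually R (inf (principal X) (filtercomap nrm (nhds (0::real)))) \<longleftrightarrow>
    (\<exists>d>0. \<forall>v\<in>X. \<bar>nrm v\<bar> < d \<longrightarrow> R v)"
proof
  assume "eventually R (inf (principal X) (filtercomap nrm (nhds 0)))"
  then obtain Q where Q: "eventually Q (nhds 0)" "\<And>v. Q (nrm v) \<Longrightarrow> v \<in> X \<Longrightarrow> R v"
    unfolding inf_commute[of "principal X"] eventually_inf_principal eventually_filtercomap by blast
  from Q(1) obtain d where "0 < d" "\<And>t. \<bar>t\<bar> < d \<Longrightarrow> Q t"
    unfolding eventually_nhds_metric by (auto simp: dist_real_def)
  with Q(2) show "\<exists>d>0. \<forall>v\<in>X. \<bar>nrm v\<bar> < d \<longrightarrow> R v"
    by blast
next
  assume "\<exists>d>0. \<forall>v\<in>X. \<bar>nrm v\<bar> < d \<longrightarrow> R v"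
  then obtain d where d: "0 < d" "\<And>v. v \<in> X \<Longrightarrow> \<bar>nrm v\<bar> < d \<Longrightarrow> R v"
    by blast
  then have "eventually (\<lambda>t. \<bar>t\<bar> < d) (nhds (0::real))"
    unfolding eventually_nhds_metric by (auto simp: dist_real_def)
  then show "eventually R (inf (principal X) (filtercomap nrm (nhds 0)))"
    unfolding inf_commute[of "principal X"] eventually_inf_principal eventually_filtercomap
    using d(2) by blast
qed

lemma has_quadratic_remainder_iff:
  "has_quadratic_remainder X nrm S W L \<longleftrightarrow>
    (\<forall>u\<in>X. \<exists>C. \<exists>d>0. \<forall>v\<in>X. \<bar>nrm v\<bar> < d \<longrightarrow>
      (\<forall>y\<in>S. \<bar>W (\<lambda>z. u z + v z) y - W u y - L u v y\<bar> \<le> C * (nrm v)\<^sup>2))"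
  unfolding has_quadratic_remainder_def eventually_small_norm_iff ..

text \<open>A quadratic remainder divided by \<open>nrm v\<close> is at most |C|
  \<open>nrm v\<close>, which tends to 0 uniformly on \<open>S\<close>. For a concrete operator only
  linearity and the quadratic bound then remain to be checked.\<close>

lemma is_linearizationI:
  assumes X: "normed_function_space D X nrm"
    and add: "\<And>u v w y. u \<in> X \<Longrightarrow> v \<in> X \<Longrightarrow> w \<in> X \<Longrightarrow> y \<in> S \<Longrightarrow>
                L u (\<lambda>z. v z + w z) y = L u v y + L u w y"
    and scale: "\<And>u c v y. u \<in> X \<Longrightarrow> v \<in> X \<Longrightarrow> y \<in> S \<Longrightarrow> L u (\<lambda>z. c * v z) y = c * L u v y"
    and rem: "has_quadratic_remainder X nrm S W L"
  shows "is_linearization X nrm S W L"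
proof -
  have "uniform_limit S (\<lambda>v y. (W (\<lambda>z. u z + v z) y - W u y - L u v y) / nrm v) (\<lambda>_. 0)
          (inf (principal X) (filtercomap nrm (at 0)))" if u: "u \<in> X" for u
  proof (rule uniform_limitI)
    fix e :: real
    assume "0 < e"
    obtain C d where "0 < d" and C: "\<And>v y. v \<in> X \<Longrightarrow> \<bar>nrm v\<bar> < d \<Longrightarrow> y \<in> S \<Longrightarrow>
        \<bar>W (\<lambda>z. u z + v z) y - W u y - L u v y\<bar> \<le> C * (nrm v)\<^sup>2"
      using rem u unfolding has_quadratic_remainder_iff by blast
    \<comment> \<open>\<open>C\<close> may be zero or negative; |C| + 1 is a positive denominator
      and still bounds \<open>C\<close>.\<close>
    define \<delta> where "\<delta> = min d (e / (\<bar>C\<bar> + 1))"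
    have \<delta>: "0 < \<delta>"
      using \<open>0 < d\<close> \<open>0 < e\<close> by (simp add: \<delta>_def)
    have small: "\<bar>(W (\<lambda>z. u z + v z) y - W u y - L u v y) / nrm v\<bar> < e"
      if v: "v \<in> X" "nrm v \<noteq> 0" "\<bar>nrm v\<bar> < \<delta>" and y: "y \<in> S" for v y
    proof -
      have pos: "0 < nrm v"
        using normed_function_space_nonneg[OF X v(1)] v(2) by simp
      have "\<bar>W (\<lambda>z. u z + v z) y - W u y - L u v y\<bar> \<le> C * (nrm v)\<^sup>2"
        using C v y by (simp add: \<delta>_def)
      also have "\<dots> \<le> (\<bar>C\<bar> + 1) * nrm v * nrm v"
        unfolding power2_eq_square mult.assoc by (intro mult_right_mono) auto
      also have "\<dots> < e * nrm v"
      proof (intro mult_strict_right_mono pos)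
        have "nrm v < e / (\<bar>C\<bar> + 1)"
          using v(3) pos by (simp add: \<delta>_def)
        then show "(\<bar>C\<bar> + 1) * nrm v < e"
          by (simp add: less_divide_eq mult.commute)
      qed
      finally show ?thesis
        using pos by (simp add: abs_divide divide_less_eq)
    qed
    have "eventually (\<lambda>t. t \<noteq> 0 \<and> \<bar>t\<bar> < \<delta>) (at (0::real))"
      unfolding eventually_at using \<delta> by (auto simp: dist_real_def)
    then show "\<forall>\<^sub>F v in inf (principal X) (filtercomap nrm (at 0)).
        \<forall>y\<in>S. dist ((W (\<lambda>z. u z + v z) y - W u y - L u v y) / nrm v) 0 < e"
      unfolding inf_commute[of "principal X"] eventually_inf_principal eventually_filtercomap
        dist_real_def diff_0_right
      using small by blast
  qed
  then show ?thesis
    unfolding is_linearization_def using add scale by blast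
qed

text \<open>Division by the norm of \<open>h\<close> leaves a bound C |h|, which vanishes in the
  limit.\<close>

lemma has_derivative_if_quadratic_remainder:
  fixes f :: "'a::real_normed_vector \<Rightarrow> 'b::real_normed_vector"
  assumes "bounded_linear f'" "0 < d"
    and rem: "\<And>h. norm h < d \<Longrightarrow> norm (f (x + h) - f x - f' h) \<le> C * (norm h)\<^sup>2"
  shows "(f has_derivative f') (at x)"
  unfolding has_derivative_at
proof
  have "((\<lambda>h::'a. C * norm h) \<longlongrightarrow> C * norm (0::'a)) (at 0)"
    by (intro tendsto_intros)
  then have lim: "((\<lambda>h::'a. C * norm h) \<longlongrightarrow> 0) (at 0)"
    by simp
  have "norm (norm (f (x + h) - f x - f' h) / norm h) \<le> C * norm h"
    if "h \<noteq> 0" "norm h < d" for h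
    using rem[OF that(2)] that(1) by (simp add: divide_le_eq power2_eq_square mult.assoc)
  then have "\<forall>\<^sub>F h in at 0. norm (norm (f (x + h) - f x - f' h) / norm h) \<le> C * norm h"
    unfolding eventually_at using \<open>0 < d\<close> by (auto intro!: exI[of _ d])
  then show "((\<lambda>h. norm (f (x + h) - f x - f' h) / norm h) \<longlongrightarrow> 0) (at 0)"
    using lim by (rule Lim_null_comparison)
qed (fact assms(1))

subsection \<open>The collocation system and its Jacobian\<close>

lemma rbf_interpolant_add:
  "rbf_interpolant P (\<alpha> + \<beta>) = (\<lambda>y. rbf_interpolant P \<alpha> y + rbf_interpolant P \<beta> y)"
  by (simp add: fun_eq_iff rbf_interpolant_def algebra_simps sum.distrib)

lemma rbf_interpolant_in_space:
  assumes "rbf_setting P"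
  shows "rbf_interpolant P \<alpha> \<in> space_of P"
proof -
  have "normed_function_space (closure (domain_of P)) (space_of P) (norm_of P)"
    and "\<And>j. rbf_at P j \<in> space_of P"
    using assms unfolding rbf_setting_def by blast+
  then have "(\<lambda>y. \<Sum>j\<in>UNIV. \<alpha> $ j * rbf_at P j y) \<in> space_of P"
    by (intro normed_function_space_sum(1)) auto
  then show ?thesis
    unfolding rbf_interpolant_def[abs_def] .
qed

text \<open>Triangle inequality, with each coordinate at most the Euclidean norm. This turns
  remainders quadratic in the function norm into remainders quadratic in the coefficients; a bound
  in the other direction would fail for linearly dependent basis functions.\<close>

lemma norm_of_rbf_interpolant_le:
  assumes "rbf_setting P"
  shows "norm_of P (rbf_interpolant P \<alpha>) \<le> (\<Sum>j\<in>UNIV. norm_of P (rbf_at P j)) * norm \<alpha>"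
proof -
  have X: "normed_function_space (closure (domain_of P)) (space_of P) (norm_of P)"
    and rbf: "\<And>j. rbf_at P j \<in> space_of P"
    using assms unfolding rbf_setting_def by blast+
  have "norm_of P (rbf_interpolant P \<alpha>) \<le> (\<Sum>j\<in>UNIV. \<bar>\<alpha> $ j\<bar> * norm_of P (rbf_at P j))"
    using normed_function_space_sum(2)[OF X, of UNIV "rbf_at P" "\<lambda>j. \<alpha> $ j"] rbf
    unfolding rbf_interpolant_def[abs_def] by simp
  also have "\<dots> \<le> (\<Sum>j\<in>UNIV. norm \<alpha> * norm_of P (rbf_at P j))"
    using normed_function_space_nonneg[OF X rbf]
    by (intro sum_mono mult_right_mono) (auto simp: component_le_norm_cart)
  finally show ?thesis
    by (simp add: sum_distrib_left sum_distrib_right mult.commute)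
qed

text \<open>Linearity is given only at points of the domain or of its frontier; each node lies in
  the set that belongs to its equation.\<close>

lemma L_at_linear:
  assumes P: "rbf_setting P" and u: "u \<in> space_of P"
  shows "v \<in> space_of P \<Longrightarrow> w \<in> space_of P \<Longrightarrow>
           L_at P u (\<lambda>z. v z + w z) i = L_at P u v i + L_at P u w i"
    and "v \<in> space_of P \<Longrightarrow> L_at P u (\<lambda>z. c * v z) i = c * L_at P u v i"
proof -
  have nodes: "i \<in> interior_idx P \<Longrightarrow> node P i \<in> domain_of P"
      "i \<notin> interior_idx P \<Longrightarrow> node P i \<in> frontier (domain_of P)"
    and lin: "is_linearization (space_of P) (norm_of P) (domain_of P) (W_PDE P) (L_PDE P)"
      "is_linearization (space_of P) (norm_of P) (frontier (domain_of P)) (W_BC P) (L_BC P)"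
    using P unfolding rbf_setting_def by blast+
  note lin = lin[unfolded is_linearization_def, THEN bspec, OF u]
  show "L_at P u (\<lambda>z. v z + w z) i = L_at P u v i + L_at P u w i"
    if "v \<in> space_of P" "w \<in> space_of P"
    using lin nodes that unfolding L_at_def by simp
  show "L_at P u (\<lambda>z. c * v z) i = c * L_at P u v i" if "v \<in> space_of P"
    using lin nodes that unfolding L_at_def by simp
qed

lemma L_at_sum:
  assumes P: "rbf_setting P" and u: "u \<in> space_of P"
    and f: "\<And>j. j \<in> A \<Longrightarrow> f j \<in> space_of P" and "finite A"
  shows "L_at P u (\<lambda>z. \<Sum>j\<in>A. c j * f j z) i = (\<Sum>j\<in>A. c j * L_at P u (f j) i)"
  using \<open>finite A\<close> f
proof (induction A rule: finite_induct)
  have X: "normed_function_space (closure (domain_of P)) (space_of P) (norm_of P)"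
    using P unfolding rbf_setting_def by blast
  {
    case empty
    \<comment> \<open>The empty sum is the zero function, written as 0 times \<open>u\<close> so
      that homogeneity applies.\<close>
    have "L_at P u (\<lambda>z. 0 * u z) i = 0 * L_at P u u i"
      using L_at_linear(2)[OF P u u] .
    then show ?case
      by simp
  next
    case (insert a A)
    have "(\<lambda>z. c a * f a z) \<in> space_of P" "(\<lambda>z. \<Sum>j\<in>A. c j * f j z) \<in> space_of P"
      using insert by (auto intro: normed_function_spaceD(4)[OF X] normed_function_space_sum(1)[OF X])
    then show ?case
      using insert L_at_linear[OF P u] by simp
  }
qed

text \<open>Expanding the interpolant by linearity shows that the collocation matrix represents the
  linearized operator, read at the nodes, with respect to the coefficients.\<close>

lemma L_at_rbf_interpolant:
  assumes P: "rbf_setting P"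
  shows "L_at P (rbf_interpolant P \<alpha>) (rbf_interpolant P \<gamma>) i = (colloc_matrix P \<alpha> *v \<gamma>) $ i"
proof -
  have "\<And>j. rbf_at P j \<in> space_of P"
    using P unfolding rbf_setting_def by blast
  then show ?thesis
    using L_at_sum[OF P rbf_interpolant_in_space[OF P], of UNIV "rbf_at P" \<alpha> "\<lambda>j. \<gamma> $ j" i]
    by (simp add: rbf_interpolant_def[of P \<gamma>, abs_def] colloc_matrix_def matrix_vector_mult_def
        mult.commute)
qed

text \<open>Differential and boundary operator come with their own constants and radii; the
  collocation system needs one of each, valid at every node.\<close>

lemma W_at_quadratic_remainder:
  assumes P: "rbf_setting P" and u: "u \<in> space_of P"
  obtains C d where "0 \<le> C" "0 < d"
    "\<And>v i. v \<in> space_of P \<Longrightarrow> norm_of P v < d \<Longrightarrow>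
      \<bar>W_at P (\<lambda>z. u z + v z) i - W_at P u i - L_at P u v i\<bar> \<le> C * (norm_of P v)\<^sup>2"
proof -
  have nodes: "i \<in> interior_idx P \<Longrightarrow> node P i \<in> domain_of P"
      "i \<notin> interior_idx P \<Longrightarrow> node P i \<in> frontier (domain_of P)" for i
    using P unfolding rbf_setting_def by blast+
  have X: "normed_function_space (closure (domain_of P)) (space_of P) (norm_of P)"
    using P unfolding rbf_setting_def by blast
  obtain C1 d1 where 1: "0 < d1" "\<And>v y. v \<in> space_of P \<Longrightarrow> \<bar>norm_of P v\<bar> < d1 \<Longrightarrow> y \<in> domain_of P \<Longrightarrow>
      \<bar>W_PDE P (\<lambda>z. u z + v z) y - W_PDE P u y - L_PDE P u v y\<bar> \<le> C1 * (norm_of P v)\<^sup>2"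
    using P u unfolding rbf_setting_def has_quadratic_remainder_iff by meson
  obtain C2 d2 where 2: "0 < d2" "\<And>v y. v \<in> space_of P \<Longrightarrow> \<bar>norm_of P v\<bar> < d2 \<Longrightarrow>
      y \<in> frontier (domain_of P) \<Longrightarrow>
      \<bar>W_BC P (\<lambda>z. u z + v z) y - W_BC P u y - L_BC P u v y\<bar> \<le> C2 * (norm_of P v)\<^sup>2"
    using P u unfolding rbf_setting_def has_quadratic_remainder_iff by meson
  show thesis
  \<comment> \<open>The given constants may have either sign, so the sum of their moduli is taken as
    common nonnegative constant; the smaller radius serves both.\<close>
  proof (rule that[of "\<bar>C1\<bar> + \<bar>C2\<bar>" "min d1 d2"])
    fix v i
    assume v: "v \<in> space_of P" "norm_of P v < min d1 d2"
    then have "\<bar>norm_of P v\<bar> < d1" "\<bar>norm_of P v\<bar> < d2"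
      using normed_function_space_nonneg[OF X v(1)] by auto
    moreover have "C1 * (norm_of P v)\<^sup>2 \<le> (\<bar>C1\<bar> + \<bar>C2\<bar>) * (norm_of P v)\<^sup>2"
      "C2 * (norm_of P v)\<^sup>2 \<le> (\<bar>C1\<bar> + \<bar>C2\<bar>) * (norm_of P v)\<^sup>2"
      by (intro mult_right_mono; simp)+
    ultimately show "\<bar>W_at P (\<lambda>z. u z + v z) i - W_at P u i - L_at P u v i\<bar>
        \<le> (\<bar>C1\<bar> + \<bar>C2\<bar>) * (norm_of P v)\<^sup>2"
      using 1(2)[OF v(1), of "node P i"] 2(2)[OF v(1), of "node P i"] nodes[of i]
      unfolding W_at_def L_at_def by fastforce
  qed (use 1(1) 2(1) in auto)
qed

text \<open>Interpolation is additive, so a coefficient increment \<open>h\<close> perturbs the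
  function by v = the interpolant of \<open>h\<close>. Every component of the remainder is then at
  most C |v|^2 \<le> C K^2 |h|^2, and summation over the components gives a quadratic
  remainder.\<close>

lemma colloc_system_has_derivative:
  assumes P: "rbf_setting (P :: ('a::euclidean_space, 'n::finite) rbf_problem)"
  shows "(colloc_system P has_derivative (*v) (colloc_matrix P \<alpha>)) (at \<alpha>)"
proof -
  have X: "normed_function_space (closure (domain_of P)) (space_of P) (norm_of P)"
    using P unfolding rbf_setting_def by blast
  obtain C d where C: "0 \<le> C" "0 < d"
    "\<And>v i. v \<in> space_of P \<Longrightarrow> norm_of P v < d \<Longrightarrow>
      \<bar>W_at P (\<lambda>z. rbf_interpolant P \<alpha> z + v z) i - W_at P (rbf_interpolant P \<alpha>) i -
        L_at P (rbf_interpolant P \<alpha>) v i\<bar> \<le> C * (norm_of P v)\<^sup>2"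
    using W_at_quadratic_remainder[OF P rbf_interpolant_in_space[OF P]] by blast
  \<comment> \<open>The summand 1 makes \<open>K\<close> positive, hence d / K meaningful, even if
    all basis functions have norm zero.\<close>
  define K where "K = (\<Sum>j\<in>UNIV. norm_of P (rbf_at P j)) + 1"
  have K: "0 < K" "norm_of P (rbf_interpolant P h) \<le> K * norm h" for h
  proof -
    have "0 \<le> (\<Sum>j\<in>UNIV. norm_of P (rbf_at P j))"
      using P normed_function_space_nonneg[OF X] unfolding rbf_setting_def
      by (intro sum_nonneg) blast
    then show "0 < K"
      by (simp add: K_def)
    show "norm_of P (rbf_interpolant P h) \<le> K * norm h"
      using norm_of_rbf_interpolant_le[OF P, of h] norm_ge_zero[of h]
      unfolding K_def distrib_right by linarith
  qed
  show ?thesis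
  proof (rule has_derivative_if_quadratic_remainder)
    show "bounded_linear ((*v) (colloc_matrix P \<alpha>))"
      by (rule matrix_vector_mul_bounded_linear)
    show "0 < d / K"
      using C(2) K(1) by simp
    fix h :: "real ^ 'n"
    assume "norm h < d / K"
    then have "K * norm h < d"
      using K(1) by (simp add: less_divide_eq mult.commute)
    then have small: "norm_of P (rbf_interpolant P h) < d"
      using K(2)[of h] by simp
    have "norm (colloc_system P (\<alpha> + h) - colloc_system P \<alpha> - colloc_matrix P \<alpha> *v h)
        \<le> (\<Sum>i\<in>UNIV. \<bar>(colloc_system P (\<alpha> + h) - colloc_system P \<alpha> - colloc_matrix P \<alpha> *v h) $ i\<bar>)"
      by (rule norm_le_l1_cart)
    also have "\<dots> \<le> (\<Sum>i\<in>(UNIV::'n set). C * (K * norm h)\<^sup>2)"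
    proof (rule sum_mono)
      fix i
      have "\<bar>(colloc_system P (\<alpha> + h) - colloc_system P \<alpha> - colloc_matrix P \<alpha> *v h) $ i\<bar>
          \<le> C * (norm_of P (rbf_interpolant P h))\<^sup>2"
        using C(3)[OF rbf_interpolant_in_space[OF P] small, of i]
        by (simp add: colloc_system_def rbf_interpolant_add L_at_rbf_interpolant[OF P])
      also have "\<dots> \<le> C * (K * norm h)\<^sup>2"
        using C(1) K(2)[of h] normed_function_space_nonneg[OF X rbf_interpolant_in_space[OF P]]
        by (intro mult_left_mono power_mono)
      finally show "\<bar>(colloc_system P (\<alpha> + h) - colloc_system P \<alpha> - colloc_matrix P \<alpha> *v h) $ i\<bar>
          \<le> C * (K * norm h)\<^sup>2" .
    qed
    also have "\<dots> = real CARD('n) * C * K\<^sup>2 * (norm h)\<^sup>2"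
      by (simp add: power_mult_distrib)
    finally show "norm (colloc_system P (\<alpha> + h) - colloc_system P \<alpha> - colloc_matrix P \<alpha> *v h)
        \<le> real CARD('n) * C * K\<^sup>2 * (norm h)\<^sup>2" .
  qed
qed

text \<open>Derivatives are unique, so the matrix that \<open>jacobian\<close> extracts from the
  chosen Frechet derivative is the one found above.\<close>

lemma jacobian_colloc_system:
  assumes "rbf_setting P"
  shows "jacobian (colloc_system P) (at \<alpha>) = colloc_matrix P \<alpha>"
  using frechet_derivative_at[OF colloc_system_has_derivative[OF assms, of \<alpha>]]
  by (metis jacobian_def matrix_of_matrix_vector_mul)

text \<open>The chain rule along the coordinate line through \<open>\<alpha>\<close> picks out
  column \<open>j\<close> of the derivative. This is the entrywise equation in terms of partial
  derivatives, independent of the definition of \<open>jacobian\<close>.\<close>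

lemma colloc_system_partial_derivative:
  assumes P: "rbf_setting P"
  shows "((\<lambda>t. colloc_system P (\<alpha> + t *\<^sub>R axis j 1) $ i) has_real_derivative
           L_at P (rbf_interpolant P \<alpha>) (rbf_at P j) i) (at 0)"
proof -
  have "((\<lambda>t::real. \<alpha> + t *\<^sub>R axis j 1) has_derivative (\<lambda>t. t *\<^sub>R axis j 1)) (at 0)"
    by (auto intro!: derivative_eq_intros)
  moreover have "(colloc_system P has_derivative (*v) (colloc_matrix P \<alpha>)) (at (\<alpha> + 0 *\<^sub>R axis j 1))"
    using colloc_system_has_derivative[OF P, of \<alpha>] by simp
  ultimately have "((\<lambda>t. colloc_system P (\<alpha> + t *\<^sub>R axis j 1)) has_derivative
      (\<lambda>t. colloc_matrix P \<alpha> *v (t *\<^sub>R axis j 1))) (at 0)"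
    by (rule has_derivative_compose)
  then have "((\<lambda>t. colloc_system P (\<alpha> + t *\<^sub>R axis j 1) $ i) has_derivative
      (\<lambda>t. (colloc_matrix P \<alpha> *v (t *\<^sub>R axis j 1)) $ i)) (at 0)"
    by (rule bounded_linear.has_derivative[OF bounded_linear_vec_nth])
  moreover have "(colloc_matrix P \<alpha> *v (t *\<^sub>R axis j 1)) $ i =
      L_at P (rbf_interpolant P \<alpha>) (rbf_at P j) i * t" for t
    by (simp add: matrix_vector_mult_scaleR matrix_vector_mult_basis column_def colloc_matrix_def)
  ultimately show ?thesis
    unfolding has_field_derivative_def by simp
qed

section \<open>Collocated corrections and Newton updates\<close>

lemma collocated_correction_iff:
  assumes "rbf_setting P"
  shows "collocated_correction P \<alpha> \<gamma> \<longleftrightarrow> colloc_matrix P \<alpha> *v \<gamma> = - colloc_system P \<alpha>"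
  unfolding collocated_correction_def vec_eq_iff L_at_rbf_interpolant[OF assms]
  by (simp add: colloc_system_def)

lemma matrix_vector_mult_eq_iff_matrix_inv:
  fixes A :: "real ^ 'n ^ 'n"
  assumes "invertible A"
  shows "A *v x = b \<longleftrightarrow> x = matrix_inv A *v b"
proof -
  \<comment> \<open>\<open>matrix_inv\<close> is a Hilbert choice; invertibility provides the
    witness that gives it the properties of an inverse.\<close>
  have "A ** matrix_inv A = mat 1 \<and> matrix_inv A ** A = mat 1"
    using assms unfolding invertible_def matrix_inv_def by (rule someI_ex)
  then show ?thesis
    by (metis matrix_vector_mul_assoc matrix_vector_mul_lid)
qed

text \<open>By invertibility the collocated linear problem has exactly one solution, minus the
  inverse matrix applied to the residual. The comparison of whole iterations needs both
  directions.\<close>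

lemma collocated_correction_update_iff:
  assumes "rbf_setting P" "invertible (colloc_matrix P \<alpha>)"
  shows "collocated_correction P \<alpha> \<gamma> \<longleftrightarrow>
    \<alpha> + \<gamma> = \<alpha> - matrix_inv (colloc_matrix P \<alpha>) *v colloc_system P \<alpha>"
  unfolding collocated_correction_iff[OF assms(1)] matrix_vector_mult_eq_iff_matrix_inv[OF assms(2)]
    linear_neg[OF matrix_vector_mul_linear]
  by (simp only: diff_conv_add_uminus add_left_cancel)

text \<open>Both iterations demand invertibility of the same matrix and prescribe the same next
  iterate, so they agree step by step; the differentiability demanded by Newton's method always
  holds here.\<close>

lemma operator_newton_iteration_iff:
  assumes P: "rbf_setting P"
  shows "operator_newton_iteration P \<alpha> \<longleftrightarrow> newton_iteration (colloc_system P) \<alpha>"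
proof -
  have "(\<exists>\<gamma>. collocated_correction P (\<alpha> k) \<gamma> \<and> \<alpha> (Suc k) = \<alpha> k + \<gamma>) \<longleftrightarrow>
      \<alpha> (Suc k) = \<alpha> k - matrix_inv (colloc_matrix P (\<alpha> k)) *v colloc_system P (\<alpha> k)"
    if "invertible (colloc_matrix P (\<alpha> k))" for k
    unfolding collocated_correction_update_iff[OF P that]
  proof
    \<comment> \<open>The correction is recovered as the difference of consecutive iterates.\<close>
    assume "\<alpha> (Suc k) = \<alpha> k - matrix_inv (colloc_matrix P (\<alpha> k)) *v colloc_system P (\<alpha> k)"
    then show "\<exists>\<gamma>. \<alpha> k + \<gamma> = \<alpha> k - matrix_inv (colloc_matrix P (\<alpha> k)) *v colloc_system P (\<alpha> k) \<and>
        \<alpha> (Suc k) = \<alpha> k + \<gamma>"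
      by (intro exI[of _ "\<alpha> (Suc k) - \<alpha> k"]) simp
  qed auto
  moreover have "colloc_system P differentiable (at (\<alpha> k))" for k
    using colloc_system_has_derivative[OF P] differentiableI by blast
  ultimately show ?thesis
    unfolding operator_newton_iteration_def newton_iteration_def jacobian_colloc_system[OF P]
    by blast
qed

subsection \<open>Partial derivatives of twice differentiable functions\<close>

text \<open>The chain rule along the line y + t b reduces \<open>partial\<close>, built on the total
  function \<open>deriv\<close>, to the Frechet derivative; differentiability is what gives
  \<open>deriv\<close> its meaning.\<close>

lemma partial_eq:
  assumes "(u has_derivative D) (at y)"
  shows "partial b u y = D b"
proof -
  have "((\<lambda>t::real. y + t *\<^sub>R b) has_derivative (\<lambda>t. t *\<^sub>R b)) (at 0)"
    by (auto intro!: derivative_eq_intros)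
  moreover have "(u has_derivative D) (at (y + 0 *\<^sub>R b))"
    using assms by simp
  ultimately have "((\<lambda>t. u (y + t *\<^sub>R b)) has_derivative (\<lambda>t. D (t *\<^sub>R b))) (at 0)"
    by (rule has_derivative_compose)
  then have "((\<lambda>t. u (y + t *\<^sub>R b)) has_real_derivative D b) (at 0)"
    unfolding has_field_derivative_def
    by (simp add: linear_scale[OF has_derivative_linear[OF assms]] mult_commute_abs)
  then show ?thesis
    unfolding partial_def by (rule DERIV_imp_deriv)
qed

lemma partial_add:
  assumes "u differentiable (at y)" "v differentiable (at y)"
  shows "partial b (\<lambda>z. u z + v z) y = partial b u y + partial b v y"
proof -
  obtain D E where "(u has_derivative D) (at y)" "(v has_derivative E) (at y)"
    using assms unfolding differentiable_def by blast
  then show ?thesis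
    using partial_eq[OF has_derivative_add] partial_eq by metis
qed

lemma partial_cmult:
  assumes "u differentiable (at y)"
  shows "partial b (\<lambda>z. c * u z) y = c * partial b u y"
proof -
  obtain D where "(u has_derivative D) (at y)"
    using assms unfolding differentiable_def by blast
  then show ?thesis
    using partial_eq[OF has_derivative_mult_right] partial_eq by metis
qed

text \<open>Since \<open>S\<close> is open, the line through \<open>y\<close> stays in
  \<open>S\<close> for small t, and \<open>deriv\<close> depends only on the germ at 0.\<close>

lemma partial_cong:
  assumes "open S" "y \<in> S" and eq: "\<And>z. z \<in> S \<Longrightarrow> u z = v z"
  shows "partial b u y = partial b v y"
proof -
  have "((\<lambda>t::real. y + t *\<^sub>R b) \<longlongrightarrow> y + 0 *\<^sub>R b) (nhds 0)"
    by (intro tendsto_intros filterlim_ident)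
  then have "\<forall>\<^sub>F t in nhds 0. y + t *\<^sub>R b \<in> S"
    using assms(1,2) by (auto dest: topological_tendstoD)
  then have "\<forall>\<^sub>F t in nhds 0. u (y + t *\<^sub>R b) = v (y + t *\<^sub>R b)"
    by eventually_elim (rule eq)
  then show ?thesis
    unfolding partial_def by (rule deriv_cong_ev) simp
qed

lemma C2_on_UNIV_D:
  assumes "C2_on UNIV u"
  shows "u differentiable (at y)" "b \<in> Basis \<Longrightarrow> partial b u differentiable (at y)"
    "b \<in> Basis \<Longrightarrow> c \<in> Basis \<Longrightarrow> continuous_on UNIV (partial c (partial b u))"
  using assms unfolding C2_on_def by blast+

lemma C2_on_subset: "C2_on T u \<Longrightarrow> S \<subseteq> T \<Longrightarrow> C2_on S u"
  unfolding C2_on_def by (blast intro: continuous_on_subset)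

lemma C2_on_UNIV_continuous: "C2_on UNIV u \<Longrightarrow> continuous_on S u"
  by (intro continuous_at_imp_continuous_on ballI differentiable_imp_continuous_within
      C2_on_UNIV_D(1))

lemma C2_on_UNIV_add:
  assumes u: "C2_on UNIV u" and v: "C2_on UNIV v"
  shows "C2_on UNIV (\<lambda>z. u z + v z)"
    and "b \<in> Basis \<Longrightarrow> partial c (partial b (\<lambda>z. u z + v z)) y =
      partial c (partial b u) y + partial c (partial b v) y"
proof -
  \<comment> \<open>The first partials are rewritten as functions on the whole space, since the
    outer partial acts on functions and not on single values.\<close>
  have 1: "partial b (\<lambda>z. u z + v z) = (\<lambda>y. partial b u y + partial b v y)" for b
    by (simp add: fun_eq_iff partial_add C2_on_UNIV_D u v)
  have 2: "partial c (\<lambda>y. partial b u y + partial b v y) =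
      (\<lambda>y. partial c (partial b u) y + partial c (partial b v) y)" if "b \<in> Basis" for b c
    using that by (simp add: fun_eq_iff partial_add C2_on_UNIV_D u v)
  show "C2_on UNIV (\<lambda>z. u z + v z)"
    unfolding C2_on_def
    using C2_on_UNIV_D[OF u] C2_on_UNIV_D[OF v] by (auto simp: 1 2 intro: continuous_on_add)
  show "partial c (partial b (\<lambda>z. u z + v z)) y =
      partial c (partial b u) y + partial c (partial b v) y" if "b \<in> Basis"
    unfolding 1 2[OF that] ..
qed

lemma C2_on_UNIV_cmult:
  assumes u: "C2_on UNIV u"
  shows "C2_on UNIV (\<lambda>z. r * u z)"
    and "b \<in> Basis \<Longrightarrow> partial c (partial b (\<lambda>z. r * u z)) y = r * partial c (partial b u) y"
proof -
  have 1: "partial b (\<lambda>z. r * u z) = (\<lambda>y. r * partial b u y)" for b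
    by (simp add: fun_eq_iff partial_cmult C2_on_UNIV_D u)
  have 2: "partial c (\<lambda>y. r * partial b u y) = (\<lambda>y. r * partial c (partial b u) y)"
    if "b \<in> Basis" for b c
    using that by (simp add: fun_eq_iff partial_cmult C2_on_UNIV_D u)
  show "C2_on UNIV (\<lambda>z. r * u z)"
    unfolding C2_on_def
    using C2_on_UNIV_D[OF u] by (auto simp: 1 2 intro: continuous_on_mult_left)
  show "partial c (partial b (\<lambda>z. r * u z)) y = r * partial c (partial b u) y" if "b \<in> Basis"
    unfolding 1 2[OF that] ..
qed

lemma partial_const: "partial b (\<lambda>_. c) = (\<lambda>_. 0)"
  by (rule ext) (rule partial_eq, rule has_derivative_const)

lemma C2_on_const: "C2_on S (\<lambda>_. c)"
  by (simp add: C2_on_def partial_const)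

lemma partial_dist_square:
  "partial b (\<lambda>y. (norm (y - x))\<^sup>2) = (\<lambda>y. 2 * ((y - x) \<bullet> b))"
proof
  fix y
  have "((\<lambda>y. (norm (y - x))\<^sup>2) has_derivative (\<lambda>h. 2 * ((y - x) \<bullet> h))) (at y)"
    unfolding power2_norm_eq_inner by (auto intro!: derivative_eq_intros simp: inner_commute)
  then show "partial b (\<lambda>y. (norm (y - x))\<^sup>2) y = 2 * ((y - x) \<bullet> b)"
    by (rule partial_eq)
qed

lemma partial2_dist_square:
  "partial c (partial b (\<lambda>y. (norm (y - x))\<^sup>2)) = (\<lambda>_. 2 * (c \<bullet> b))"
  unfolding partial_dist_square
  by (rule ext) (rule partial_eq, auto intro!: derivative_eq_intros)

lemma C2_on_dist_square: "C2_on S (\<lambda>y. (norm (y - x))\<^sup>2)"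
proof -
  have "(\<lambda>y. (norm (y - x))\<^sup>2) differentiable (at y)"
    "(\<lambda>y. 2 * ((y - x) \<bullet> b)) differentiable (at y)" for b y
    unfolding power2_norm_eq_inner by (auto intro!: derivative_intros)
  then show ?thesis
    unfolding C2_on_def partial2_dist_square unfolding partial_dist_square by simp
qed

section \<open>The Laplacian\<close>

definition laplacian :: "('a::euclidean_space \<Rightarrow> real) \<Rightarrow> 'a \<Rightarrow> real" where
  "laplacian u y = (\<Sum>b\<in>Basis. partial b (partial b u) y)"

lemma laplacian_add:
  "C2_on UNIV u \<Longrightarrow> C2_on UNIV v \<Longrightarrow> laplacian (\<lambda>z. u z + v z) y = laplacian u y + laplacian v y"
  by (simp add: laplacian_def C2_on_UNIV_add(2) sum.distrib)

lemma laplacian_cmult: "C2_on UNIV u \<Longrightarrow> laplacian (\<lambda>z. c * u z) y = c * laplacian u y"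
  by (simp add: laplacian_def C2_on_UNIV_cmult(2) sum_distrib_left)

lemma laplacian_const: "laplacian (\<lambda>_. c) y = 0"
  by (simp add: laplacian_def partial_const)

lemma laplacian_dist_square:
  "laplacian (\<lambda>y. (norm (y - x))\<^sup>2) (y::'a::euclidean_space) = 2 * real DIM('a)"
  by (simp add: laplacian_def partial2_dist_square)

lemma laplacian_cong:
  assumes "open S" "y \<in> S" "\<And>z. z \<in> S \<Longrightarrow> u z = v z"
  shows "laplacian u y = laplacian v y"
  unfolding laplacian_def by (intro sum.cong refl partial_cong[OF assms(1)] assms)

subsection \<open>The supremum norm on the closed unit ball\<close>

text \<open>A norm without derivatives suffices for the example: the Laplacian enters linearly and
  drops out of the Taylor remainder, which depends on values only.\<close>

definition unit_ball_norm :: "('a::euclidean_space \<Rightarrow> real) \<Rightarrow> real" where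
  "unit_ball_norm u = (SUP y\<in>cball 0 1. \<bar>u y\<bar>)"

text \<open>A continuous function is bounded on the compact ball, so the supremum is a genuine upper
  bound.\<close>

lemma abs_le_unit_ball_norm:
  assumes "continuous_on (cball 0 1) u" "y \<in> cball 0 1"
  shows "\<bar>u y\<bar> \<le> unit_ball_norm u"
proof -
  have "compact ((\<lambda>y. \<bar>u y\<bar>) ` cball 0 1)"
    using assms(1) by (intro compact_continuous_image continuous_intros) auto
  then have "bdd_above ((\<lambda>y. \<bar>u y\<bar>) ` cball 0 1)"
    by (intro bounded_imp_bdd_above compact_imp_bounded)
  then show ?thesis
    unfolding unit_ball_norm_def using assms(2) by (intro cSUP_upper)
qed

lemma unit_ball_norm_le:
  "(\<And>y. y \<in> cball 0 1 \<Longrightarrow> \<bar>u y\<bar> \<le> M) \<Longrightarrow> unit_ball_norm u \<le> M"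
  unfolding unit_ball_norm_def by (rule cSUP_least) auto

lemma unit_ball_norm_cmult_le:
  assumes "continuous_on (cball 0 1) u"
  shows "unit_ball_norm (\<lambda>y. c * u y) \<le> \<bar>c\<bar> * unit_ball_norm u"
  using abs_le_unit_ball_norm[OF assms]
  by (intro unit_ball_norm_le) (simp add: abs_mult mult_left_mono)

text \<open>The inequality is used for the factor \<open>c\<close> and, on the scaled function, for
  its inverse.\<close>

lemma unit_ball_norm_cmult:
  assumes u: "continuous_on (cball 0 1) u"
  shows "unit_ball_norm (\<lambda>y. c * u y) = \<bar>c\<bar> * unit_ball_norm u"
proof (cases "c = 0")
  case False
  have "unit_ball_norm (\<lambda>y. inverse c * (c * u y)) \<le> \<bar>inverse c\<bar> * unit_ball_norm (\<lambda>y. c * u y)"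
    using u by (intro unit_ball_norm_cmult_le continuous_intros)
  with False have "\<bar>c\<bar> * unit_ball_norm u \<le> unit_ball_norm (\<lambda>y. c * u y)"
    by (simp add: abs_inverse field_simps)
  with unit_ball_norm_cmult_le[OF u, of c] show ?thesis
    by simp
qed (simp add: unit_ball_norm_def)

lemma normed_function_space_C2_unit_ball:
  "normed_function_space (cball 0 1) (Collect (C2_on UNIV)) unit_ball_norm"
proof -
  have "unit_ball_norm (\<lambda>y. u y + v y) \<le> unit_ball_norm u + unit_ball_norm v"
    if "C2_on UNIV u" "C2_on UNIV v" for u v :: "'a \<Rightarrow> real"
  proof (rule unit_ball_norm_le)
    fix y :: 'a
    assume "y \<in> cball 0 1"
    then show "\<bar>u y + v y\<bar> \<le> unit_ball_norm u + unit_ball_norm v"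
      using abs_le_unit_ball_norm[of u y] abs_le_unit_ball_norm[of v y] that
      by (simp add: C2_on_UNIV_continuous)
  qed
  moreover have "unit_ball_norm u = 0 \<longleftrightarrow> (\<forall>y\<in>cball 0 1. u y = 0)" if "C2_on UNIV u"
    for u :: "'a \<Rightarrow> real"
  proof
    assume "unit_ball_norm u = 0"
    then show "\<forall>y\<in>cball 0 1. u y = 0"
      using abs_le_unit_ball_norm[OF C2_on_UNIV_continuous[OF that]] by fastforce
  next
    assume "\<forall>y\<in>cball 0 1. u y = 0"
    then have "unit_ball_norm u = (SUP y\<in>(cball 0 1 :: 'a set). 0)"
      unfolding unit_ball_norm_def by (intro SUP_cong) auto
    then show "unit_ball_norm u = 0"
      by simp
  qed
  ultimately show ?thesis
    unfolding normed_function_space_def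
    by (simp add: C2_on_const C2_on_UNIV_add(1) C2_on_UNIV_cmult(1) unit_ball_norm_cmult
        C2_on_UNIV_continuous)
qed

subsection \<open>A Newton two-cycle for a semilinear Dirichlet problem\<close>

text \<open>
  For coefficients \<open>(0, s)\<close> the boundary equation holds and the interpolant has value \<open>s\<close> and
  Laplacian \<open>2 d s\<close> at the interior node \<open>0\<close>; the constant \<open>2 d + 5\<close> makes the residual there
  \<open>s\<^sup>3 - 5 s\<close>.
\<close>

definition cubic_problem :: "('a::euclidean_space, 2) rbf_problem" where
  "cubic_problem =
    \<lparr>domain_of = ball 0 1, space_of = Collect (C2_on UNIV), norm_of = unit_ball_norm,
     W_PDE = (\<lambda>u y. laplacian u y + (u y) ^ 3 - (2 * real DIM('a) + 5) * u y),
     W_BC = (\<lambda>u. u),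
     L_PDE = (\<lambda>u v y. laplacian v y + (3 * (u y)\<^sup>2 - (2 * real DIM('a) + 5)) * v y),
     L_BC = (\<lambda>u v. v),
     rbf = (\<lambda>r. r\<^sup>2),
     node = (\<lambda>i. if i = 1 then 0 else (SOME b. b \<in> Basis)),
     interior_idx = {1}\<rparr>"

lemma cubic_problem_simps [simp]:
  "domain_of cubic_problem = ball 0 1"
  "space_of cubic_problem = Collect (C2_on UNIV)"
  "norm_of cubic_problem = unit_ball_norm"
  "W_PDE (cubic_problem :: ('a::euclidean_space, 2) rbf_problem) =
    (\<lambda>u y. laplacian u y + (u y) ^ 3 - (2 * real DIM('a) + 5) * u y)"
  "W_BC cubic_problem = (\<lambda>u. u)"
  "L_PDE (cubic_problem :: ('a::euclidean_space, 2) rbf_problem) =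
    (\<lambda>u v y. laplacian v y + (3 * (u y)\<^sup>2 - (2 * real DIM('a) + 5)) * v y)"
  "L_BC cubic_problem = (\<lambda>u v. v)"
  "rbf cubic_problem = (\<lambda>r. r\<^sup>2)"
  "node cubic_problem = (\<lambda>i. if i = 1 then 0 else (SOME b. b \<in> Basis))"
  "interior_idx cubic_problem = {1}"
  by (simp_all add: cubic_problem_def)

text \<open>The boundary node is an unspecified basis vector; its unit norm puts it on the sphere
  and separates it from the centre.\<close>

lemma norm_some_Basis [simp]: "norm (SOME b. b \<in> (Basis :: 'a::euclidean_space set)) = 1"
  by (rule norm_Basis) (rule someI_ex, use nonempty_Basis in blast)

section \<open>The hypotheses for the cubic problem\<close>

lemma rbf_at_cubic_problem:
  "rbf_at cubic_problem j = (\<lambda>y. (norm (y - node cubic_problem j))\<^sup>2)"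
  by (simp add: fun_eq_iff rbf_at_def)

text \<open>The Laplacian and the linear term cancel, and (u + v)^3 - u^3 - 3 u^2 v = (3 u + v) v^2.
  For |v| < 1 the first factor is at most 3 |u| + 1 in modulus, a constant that may depend on
  \<open>u\<close>.\<close>

lemma has_quadratic_remainder_cubic_PDE:
  "has_quadratic_remainder (Collect (C2_on UNIV)) unit_ball_norm (ball 0 1)
    (W_PDE (cubic_problem :: ('a::euclidean_space, 2) rbf_problem)) (L_PDE cubic_problem)"
  unfolding has_quadratic_remainder_iff
proof (intro ballI)
  fix u :: "'a \<Rightarrow> real"
  assume "u \<in> Collect (C2_on UNIV)"
  then have u: "C2_on UNIV u" by simp
  have "\<bar>W_PDE cubic_problem (\<lambda>z. u z + v z) y - W_PDE cubic_problem u y - L_PDE cubic_problem u v y\<bar>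
      \<le> (3 * unit_ball_norm u + 1) * (unit_ball_norm v)\<^sup>2"
    if v: "C2_on UNIV v" "\<bar>unit_ball_norm v\<bar> < 1" and y: "y \<in> ball 0 1" for v y
  proof -
    have uy: "\<bar>u y\<bar> \<le> unit_ball_norm u" and vy: "\<bar>v y\<bar> \<le> unit_ball_norm v"
      using y u v(1) by (auto intro!: abs_le_unit_ball_norm C2_on_UNIV_continuous)
    have "W_PDE cubic_problem (\<lambda>z. u z + v z) y - W_PDE cubic_problem u y - L_PDE cubic_problem u v y
        = (3 * u y + v y) * (v y)\<^sup>2"
      by (simp add: laplacian_add u v(1) algebra_simps power2_eq_square power3_eq_cube)
    also have "\<bar>\<dots>\<bar> \<le> (3 * unit_ball_norm u + 1) * (unit_ball_norm v)\<^sup>2"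
      unfolding abs_mult
    proof (rule mult_mono)
      show "\<bar>3 * u y + v y\<bar> \<le> 3 * unit_ball_norm u + 1"
        using uy vy v(2) by linarith
      show "\<bar>(v y)\<^sup>2\<bar> \<le> (unit_ball_norm v)\<^sup>2"
        using power_mono[OF vy, of 2] by simp
    qed (use uy in auto)
    finally show ?thesis .
  qed
  then show "\<exists>C. \<exists>d>0. \<forall>v\<in>Collect (C2_on UNIV). \<bar>unit_ball_norm v\<bar> < d \<longrightarrow> (\<forall>y\<in>ball 0 1.
      \<bar>W_PDE cubic_problem (\<lambda>z. u z + v z) y - W_PDE cubic_problem u y - L_PDE cubic_problem u v y\<bar>
      \<le> C * (unit_ball_norm v)\<^sup>2)"
    by (intro exI[of _ "3 * unit_ball_norm u + 1"] exI[of _ "1::real"]) simp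
qed

text \<open>The boundary operator is its own linearization, so the remainder is exactly
  zero.\<close>

lemma has_quadratic_remainder_cubic_BC:
  "has_quadratic_remainder (Collect (C2_on UNIV)) unit_ball_norm (sphere 0 1)
    (W_BC cubic_problem) (L_BC cubic_problem)"
  unfolding has_quadratic_remainder_iff by (auto intro!: exI[of _ 0] exI[of _ "1::real"])

lemma rbf_setting_cubic_problem: "rbf_setting (cubic_problem :: ('a::euclidean_space, 2) rbf_problem)"
proof -
  let ?Q = "cubic_problem :: ('a, 2) rbf_problem"
  have closure: "closure (ball (0::'a) 1) = cball 0 1" and frontier: "frontier (ball (0::'a) 1) = sphere 0 1"
    by (simp_all add: closure_ball frontier_ball)
  have "inj (node ?Q)"
    unfolding inj_def forall_2 using norm_some_Basis[where 'a = 'a]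
    by (auto simp del: norm_some_Basis)
  moreover have "is_linearization (Collect (C2_on UNIV)) unit_ball_norm (ball 0 1) (W_PDE ?Q) (L_PDE ?Q)"
    by (rule is_linearizationI[OF normed_function_space_C2_unit_ball _ _
          has_quadratic_remainder_cubic_PDE])
      (simp_all add: laplacian_add laplacian_cmult algebra_simps)
  moreover have "is_linearization (Collect (C2_on UNIV)) unit_ball_norm (sphere 0 1) (W_BC ?Q) (L_BC ?Q)"
    by (rule is_linearizationI[OF normed_function_space_C2_unit_ball _ _
          has_quadratic_remainder_cubic_BC]) auto
  moreover have "acts_on_values (cball 0 1) (Collect (C2_on UNIV)) (ball 0 1) (W_PDE ?Q)"
    unfolding acts_on_values_def
  proof (intro ballI impI)
    fix u v :: "'a \<Rightarrow> real" and y :: 'a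
    assume eq: "\<forall>y\<in>cball 0 1. u y = v y" and y: "y \<in> ball 0 1"
    \<comment> \<open>Agreement on the closed ball implies agreement near each interior point, which
      determines the second derivatives there.\<close>
    have "laplacian u y = laplacian v y"
      by (rule laplacian_cong[OF open_ball y]) (use eq in auto)
    moreover have "u y = v y"
      using eq y by auto
    ultimately show "W_PDE ?Q u y = W_PDE ?Q v y"
      by simp
  qed
  moreover have "acts_on_values (cball 0 1) (Collect (C2_on UNIV)) (sphere 0 1) (W_BC ?Q)"
    unfolding acts_on_values_def by auto
  ultimately show ?thesis
    using has_quadratic_remainder_cubic_PDE[where 'a = 'a]
      has_quadratic_remainder_cubic_BC[where 'a = 'a]
      normed_function_space_C2_unit_ball[where 'a = 'a]
    unfolding rbf_setting_def rbf_at_cubic_problem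
    by (simp add: closure frontier C2_on_dist_square)
qed

lemma elliptic_cubic_problem: "elliptic_problem (cubic_problem :: ('a::euclidean_space, 2) rbf_problem)"
proof -
  let ?Q = "cubic_problem :: ('a, 2) rbf_problem"
  \<comment> \<open>The coefficient matrix of the Laplacian: the Kronecker delta, constant in
    \<open>y\<close>, whose symbol is the squared length of the covector.\<close>
  define I :: "'a \<Rightarrow> 'a \<Rightarrow> 'a \<Rightarrow> real" where "I y b c = (if b = c then 1 else 0)" for y b c
  have I_sum: "(\<Sum>c\<in>Basis. I y b c * g c) = g b" if "b \<in> Basis" for y b and g :: "'a \<Rightarrow> real"
    using that by (simp add: I_def if_distrib[of "\<lambda>x. x * _"] cong: if_cong)
  have symbol: "(\<Sum>b\<in>Basis. \<Sum>c\<in>Basis. I y b c * (\<xi> \<bullet> b) * (\<xi> \<bullet> c)) \<noteq> 0" if "\<xi> \<noteq> 0" for y \<xi>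
  proof -
    have "(\<Sum>b\<in>Basis. \<Sum>c\<in>Basis. I y b c * (\<xi> \<bullet> b) * (\<xi> \<bullet> c)) = \<xi> \<bullet> \<xi>"
      unfolding mult.assoc by (simp add: I_sum euclidean_inner[of \<xi> \<xi>])
    with that show ?thesis
      by simp
  qed
  have "\<exists>F. \<forall>u\<in>space_of ?Q. \<forall>y\<in>domain_of ?Q.
      W_PDE ?Q u y = F y (u y) (\<lambda>b. partial b u y) (\<lambda>b c. partial b (partial c u) y)"
    \<comment> \<open>The Laplacian is the trace of the Hessian argument \<open>q\<close>.\<close>
    by (rule exI[of _ "\<lambda>y z p q. (\<Sum>b\<in>Basis. q b b) + z ^ 3 - (2 * real DIM('a) + 5) * z"])
      (simp add: laplacian_def)
  moreover have "\<forall>u\<in>space_of ?Q. \<exists>A B C.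
      (\<forall>y\<in>domain_of ?Q. \<forall>\<xi>. \<xi> \<noteq> 0 \<longrightarrow> (\<Sum>b\<in>Basis. \<Sum>c\<in>Basis. A y b c * (\<xi> \<bullet> b) * (\<xi> \<bullet> c)) \<noteq> 0) \<and>
      (\<forall>v\<in>space_of ?Q. \<forall>y\<in>domain_of ?Q. L_PDE ?Q u v y =
        (\<Sum>b\<in>Basis. \<Sum>c\<in>Basis. A y b c * partial b (partial c v) y) +
        (\<Sum>b\<in>Basis. B y b * partial b v y) + C y * v y)"
  proof
    fix u :: "'a \<Rightarrow> real"
    have "L_PDE ?Q u v y =
        (\<Sum>b\<in>Basis. \<Sum>c\<in>Basis. I y b c * partial b (partial c v) y) +
        (\<Sum>b\<in>Basis. 0 * partial b v y) + (3 * (u y)\<^sup>2 - (2 * real DIM('a) + 5)) * v y" for v y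
      by (simp add: laplacian_def I_sum)
    then show "\<exists>A B C.
        (\<forall>y\<in>domain_of ?Q. \<forall>\<xi>. \<xi> \<noteq> 0 \<longrightarrow> (\<Sum>b\<in>Basis. \<Sum>c\<in>Basis. A y b c * (\<xi> \<bullet> b) * (\<xi> \<bullet> c)) \<noteq> 0) \<and>
        (\<forall>v\<in>space_of ?Q. \<forall>y\<in>domain_of ?Q. L_PDE ?Q u v y =
          (\<Sum>b\<in>Basis. \<Sum>c\<in>Basis. A y b c * partial b (partial c v) y) +
          (\<Sum>b\<in>Basis. B y b * partial b v y) + C y * v y)"
      using symbol
      by (intro exI[of _ I] exI[of _ "\<lambda>_ _. 0"]
          exI[of _ "\<lambda>y. 3 * (u y)\<^sup>2 - (2 * real DIM('a) + 5)"]) blast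
  qed
  moreover have "Collect (C2_on UNIV) \<subseteq> space_of ?Q" "space_of ?Q \<subseteq> Collect (C2_on (domain_of ?Q))"
    by (auto intro: C2_on_subset)
  ultimately show ?thesis
    unfolding elliptic_problem_def by blast
qed

text \<open>The zero function is a solution, so the failure of convergence below cannot be blamed on
  an unsolvable problem.\<close>

lemma cubic_problem_solvable:
  "\<exists>u\<in>space_of cubic_problem.
    (\<forall>y\<in>domain_of cubic_problem. W_PDE (cubic_problem :: ('a::euclidean_space, 2) rbf_problem) u y = 0) \<and>
    (\<forall>y\<in>frontier (domain_of cubic_problem). W_BC cubic_problem u y = 0)"
  by (rule bexI[of _ "\<lambda>_. 0"]) (simp_all add: laplacian_const C2_on_const)

section \<open>The collocation system with two nodes\<close>

lemma rbf_interpolant_cubic_problem: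
  "rbf_interpolant cubic_problem \<alpha> =
    (\<lambda>y. \<alpha> $ 1 * rbf_at cubic_problem 1 y + \<alpha> $ 2 * rbf_at cubic_problem 2 y)"
  by (simp add: fun_eq_iff rbf_interpolant_def sum_2)

lemma C2_on_rbf_at_cubic_problem: "C2_on UNIV (rbf_at cubic_problem j)"
  unfolding rbf_at_cubic_problem by (rule C2_on_dist_square)

lemma laplacian_rbf_at_cubic_problem:
  "laplacian (rbf_at cubic_problem j) (y::'a::euclidean_space) = 2 * real DIM('a)"
  unfolding rbf_at_cubic_problem by (rule laplacian_dist_square)

text \<open>The nodes are at distance 1 and the radial function is the square.\<close>

lemma rbf_at_node_cubic_problem:
  "rbf_at cubic_problem i (node cubic_problem j) = (if i = j then 0 else 1)"
  using exhaust_2[of i] exhaust_2[of j] by (auto simp: rbf_at_cubic_problem)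

text \<open>Each basis function vanishes at its own node, is 1 at the other, and has constant
  Laplacian 2 d. Hence the interpolant has value \<open>\<alpha> $ 2\<close> at the centre and
  \<open>\<alpha> $ 1\<close> at the boundary node.\<close>

lemma colloc_system_cubic_problem:
  fixes \<alpha> :: "real ^ 2"
  defines "Q \<equiv> cubic_problem :: ('a::euclidean_space, 2) rbf_problem"
  shows "colloc_system Q \<alpha> $ 1 =
      2 * real DIM('a) * (\<alpha> $ 1 + \<alpha> $ 2) + (\<alpha> $ 2) ^ 3 - (2 * real DIM('a) + 5) * \<alpha> $ 2"
    and "colloc_system Q \<alpha> $ 2 = \<alpha> $ 1"
  using rbf_at_node_cubic_problem[where 'a = 'a, of 1 1] rbf_at_node_cubic_problem[where 'a = 'a, of 1 2]
    rbf_at_node_cubic_problem[where 'a = 'a, of 2 1] rbf_at_node_cubic_problem[where 'a = 'a, of 2 2]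
  by (simp_all add: Q_def colloc_system_def W_at_def rbf_interpolant_cubic_problem laplacian_add
      laplacian_cmult C2_on_UNIV_cmult(1) C2_on_rbf_at_cubic_problem laplacian_rbf_at_cubic_problem
      algebra_simps)

text \<open>Computed from the linearized operators. The boundary row fixes the first coefficient of
  the correction, and the determinant 5 - 3 s^2, with s = \<open>\<alpha> $ 2\<close>, is nonzero at
  s = 1 and s = -1.\<close>

lemma colloc_matrix_cubic_problem:
  fixes \<alpha> :: "real ^ 2"
  defines "Q \<equiv> cubic_problem :: ('a::euclidean_space, 2) rbf_problem"
  shows "colloc_matrix Q \<alpha> $ 1 $ 1 = 2 * real DIM('a)"
    and "colloc_matrix Q \<alpha> $ 1 $ 2 = 3 * (\<alpha> $ 2)\<^sup>2 - 5"
    and "colloc_matrix Q \<alpha> $ 2 $ 1 = 1"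
    and "colloc_matrix Q \<alpha> $ 2 $ 2 = 0"
  using rbf_at_node_cubic_problem[where 'a = 'a, of 1 1] rbf_at_node_cubic_problem[where 'a = 'a, of 1 2]
    rbf_at_node_cubic_problem[where 'a = 'a, of 2 1] rbf_at_node_cubic_problem[where 'a = 'a, of 2 2]
  by (simp_all add: Q_def colloc_matrix_def L_at_def rbf_interpolant_cubic_problem
      laplacian_rbf_at_cubic_problem)

text \<open>Along coefficients (0, s) the method is Newton's for f(s) = s^3 - 5 s. At s = 1 and s =
  -1 it holds that f(s) = -4 s and f'(s) = -2, so the step is -2 s and s is sent to -s.\<close>

lemma operator_newton_cubic_problem_oscillates:
  "operator_newton_iteration (cubic_problem :: ('a::euclidean_space, 2) rbf_problem)
    (\<lambda>k. (-1) ^ k *\<^sub>R axis 2 1)"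
  unfolding operator_newton_iteration_def
proof
  fix k
  let ?Q = "cubic_problem :: ('a, 2) rbf_problem" and ?\<alpha> = "\<lambda>k. (-1) ^ k *\<^sub>R axis 2 1 :: real ^ 2"
  define a where "a = ?\<alpha> k"
  have comps: "a $ 1 = 0" "a $ 2 = (-1) ^ k"
    by (simp_all add: a_def axis_def)
  have sq: "((-1) ^ k)\<^sup>2 = (1::real)"
    by (simp flip: power_mult)
  have "((-1) ^ k) ^ 3 = (-1::real) ^ k"
    by (simp add: power3_eq_cube flip: power2_eq_square power_mult)
  note entries = colloc_matrix_cubic_problem[where 'a = 'a, of a, unfolded comps sq]
    colloc_system_cubic_problem[where 'a = 'a, of a, unfolded comps this]
  have "det (colloc_matrix ?Q a) = 2"
    by (simp add: det_2 entries)
  \<comment> \<open>With s^2 = 1 the first row reads (3 - 5) (-2 s) = 4 s = -(s - 5 s); the boundary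
    row reads 0 = 0.\<close>
  moreover have "colloc_matrix ?Q a *v (-2 *\<^sub>R a) = - colloc_system ?Q a"
    unfolding vec_eq_iff forall_2 matrix_vector_mult_def
    by (simp add: sum_2 entries comps algebra_simps)
  moreover have "?\<alpha> (Suc k) = a + (-2 *\<^sub>R a)"
    unfolding vec_eq_iff a_def by (simp add: algebra_simps)
  ultimately show "invertible (colloc_matrix ?Q (?\<alpha> k)) \<and>
      (\<exists>\<gamma>. collocated_correction ?Q (?\<alpha> k) \<gamma> \<and> ?\<alpha> (Suc k) = ?\<alpha> k + \<gamma>)"
    unfolding invertible_det_nz collocated_correction_iff[OF rbf_setting_cubic_problem]
      a_def[symmetric]
    by (intro conjI exI[of _ "-2 *\<^sub>R a"]) simp_all
qed

text \<open>Shifting the sequence by one negates it, so a limit satisfies l = -l and is 0, whereas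
  all terms have the norm of \<open>x\<close>.\<close>

lemma not_convergent_alternating:
  fixes x :: "'a::real_normed_vector"
  assumes "x \<noteq> 0"
  shows "\<not> convergent (\<lambda>k. (-1) ^ k *\<^sub>R x)"
proof
  assume "convergent (\<lambda>k. (-1) ^ k *\<^sub>R x)"
  then obtain l where l: "(\<lambda>k. (-1) ^ k *\<^sub>R x) \<longlonglongrightarrow> l"
    by (auto simp: convergent_def)
  have "(\<lambda>k. - ((-1) ^ k *\<^sub>R x)) \<longlonglongrightarrow> l"
    using LIMSEQ_Suc[OF l] by simp
  then have "l = - l"
    using tendsto_minus[OF l] LIMSEQ_unique by blast
  then have "2 *\<^sub>R l = 0"
    unfolding scaleR_2 by (metis add.right_inverse)
  then have "l = 0"
    by simp
  then have "(\<lambda>k. norm ((-1::real) ^ k *\<^sub>R x)) \<longlonglongrightarrow> 0"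
    using tendsto_norm[OF l] by (simp only: norm_zero)
  then show False
    using assms by (simp add: power_abs LIMSEQ_const_iff)
qed

text \<open>Failure of global convergence is an existence statement. The example is elliptic, has
  one interior and one boundary node, and is solvable both as a boundary value problem and as a
  collocation system; every matrix along the iteration is invertible, so the failure is one of the
  starting point.\<close>

theorem mainTheorem2:
  shows
    "(\<forall>P :: ('a::euclidean_space, 'n::finite) rbf_problem. rbf_setting P \<longrightarrow>
        (\<forall>\<alpha>. colloc_system P differentiable (at \<alpha>) \<and>
             jacobian (colloc_system P) (at \<alpha>) = colloc_matrix P \<alpha> \<and>
             (\<forall>i j. ((\<lambda>t. colloc_system P (\<alpha> + t *\<^sub>R axis j 1) $ i) has_real_derivative
                      L_at P (rbf_interpolant P \<alpha>) (rbf_at P j) i) (at 0))) \<and>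
        (\<forall>\<alpha> \<gamma>. collocated_correction P \<alpha> \<gamma> \<longleftrightarrow> colloc_matrix P \<alpha> *v \<gamma> = - colloc_system P \<alpha>) \<and>
        (\<forall>\<alpha> \<gamma>. invertible (colloc_matrix P \<alpha>) \<longrightarrow> collocated_correction P \<alpha> \<gamma> \<longrightarrow>
             \<alpha> + \<gamma> = \<alpha> - matrix_inv (colloc_matrix P \<alpha>) *v colloc_system P \<alpha> \<and>
             \<alpha> + \<gamma> = \<alpha> - matrix_inv (jacobian (colloc_system P) (at \<alpha>)) *v colloc_system P \<alpha>) \<and>
        (\<forall>\<alpha>. operator_newton_iteration P \<alpha> \<longleftrightarrow> newton_iteration (colloc_system P) \<alpha>)) \<and>
     (\<exists>Q :: ('a, 2) rbf_problem.
        rbf_setting Q \<and> elliptic_problem Q \<and>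
        interior_idx Q \<noteq> {} \<and> interior_idx Q \<noteq> UNIV \<and>
        (\<exists>u\<in>space_of Q. (\<forall>y\<in>domain_of Q. W_PDE Q u y = 0) \<and> (\<forall>y\<in>frontier (domain_of Q). W_BC Q u y = 0)) \<and>
        (\<exists>\<alpha>. colloc_system Q \<alpha> = 0) \<and>
        (\<exists>\<alpha>. operator_newton_iteration Q \<alpha> \<and> newton_iteration (colloc_system Q) \<alpha> \<and>
             \<not> convergent \<alpha>))"
proof (intro conjI allI impI)
  fix P :: "('a, 'n) rbf_problem" and \<alpha> \<gamma> :: "real ^ 'n" and \<beta> :: "nat \<Rightarrow> real ^ 'n" and i j
  assume P: "rbf_setting P"
  show "colloc_system P differentiable (at \<alpha>)"
    using colloc_system_has_derivative[OF P] by (rule differentiableI)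
  show "jacobian (colloc_system P) (at \<alpha>) = colloc_matrix P \<alpha>"
    using P by (rule jacobian_colloc_system)
  show "((\<lambda>t. colloc_system P (\<alpha> + t *\<^sub>R axis j 1) $ i) has_real_derivative
      L_at P (rbf_interpolant P \<alpha>) (rbf_at P j) i) (at 0)"
    using P by (rule colloc_system_partial_derivative)
  show "collocated_correction P \<alpha> \<gamma> \<longleftrightarrow> colloc_matrix P \<alpha> *v \<gamma> = - colloc_system P \<alpha>"
    using P by (rule collocated_correction_iff)
  show "operator_newton_iteration P \<beta> \<longleftrightarrow> newton_iteration (colloc_system P) \<beta>"
    using P by (rule operator_newton_iteration_iff)
  assume "invertible (colloc_matrix P \<alpha>)" "collocated_correction P \<alpha> \<gamma>"
  then show "\<alpha> + \<gamma> = \<alpha> - matrix_inv (colloc_matrix P \<alpha>) *v colloc_system P \<alpha>"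
    using collocated_correction_update_iff[OF P] by blast
  then show "\<alpha> + \<gamma> = \<alpha> - matrix_inv (jacobian (colloc_system P) (at \<alpha>)) *v colloc_system P \<alpha>"
    by (simp only: jacobian_colloc_system[OF P])
next
  let ?Q = "cubic_problem :: ('a, 2) rbf_problem"
  \<comment> \<open>The discrete solution is the zero vector, the midpoint of the two points of the
    cycle.\<close>
  have "colloc_system ?Q 0 = 0"
    by (simp add: vec_eq_iff forall_2 colloc_system_cubic_problem)
  moreover have "{1} \<noteq> (UNIV :: 2 set)"
    by (auto simp: UNIV_2)
  moreover have "axis 2 1 \<noteq> (0 :: real ^ 2)"
    by simp
  ultimately show "\<exists>Q :: ('a, 2) rbf_problem.
        rbf_setting Q \<and> elliptic_problem Q \<and>
        interior_idx Q \<noteq> {} \<and> interior_idx Q \<noteq> UNIV \<and>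
        (\<exists>u\<in>space_of Q. (\<forall>y\<in>domain_of Q. W_PDE Q u y = 0) \<and> (\<forall>y\<in>frontier (domain_of Q). W_BC Q u y = 0)) \<and>
        (\<exists>\<alpha>. colloc_system Q \<alpha> = 0) \<and>
        (\<exists>\<alpha>. operator_newton_iteration Q \<alpha> \<and> newton_iteration (colloc_system Q) \<alpha> \<and>
             \<not> convergent \<alpha>)"
    using operator_newton_iteration_iff[OF rbf_setting_cubic_problem] cubic_problem_solvable
      operator_newton_cubic_problem_oscillates not_convergent_alternating
      rbf_setting_cubic_problem elliptic_cubic_problem cubic_problem_simps(10)
    by (metis insert_not_empty)
qed

end
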